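(* Let $k\le 0$ and $m\in\mathbb{N}$. Suppose $A$ and $B$ are two nonempty closed and convex subsets of the model space $M_k^m$ with $A\cap B\neq\emptyset$. Let $T=\frac{I+R_AR_B}{2}$, i.e. $Tx$ is the midpoint of the geodesic segment joining $x$ and $R_A(R_Bx)$. Let $x_0\in M_k^m$ and let $(x_n)$ be the sequence starting at $x_0$ generated by the averaged alternating reflection (AAR) method, that is, $x_n=T^nx_0$ for every $n\ge1$. Then: (1) $(x_n)$ converges to some fixed point $x$ of the mapping $T$, and $P_Bx\in A\cap B$. (2) The "shadow" sequence $(P_Bx_n)$ is convergent and its limit belongs to $A\cap B$.
   Context: Model spaces: for $k=0$, $M_0^m$ is Euclidean space $\mathbb{E}^m$; for $k<0$, $M_k^m$ is the $m$-dimensional hyperbolic space $\mathbb{H}^m$ (curvature $-1$) with its hyperbolic distance multiplied by $1/\sqrt{-k}$. Any two points are joined by a unique geodesic segment; a subset is convex if it contains the geodesic segment joining any two of its points. Convergence is with respect to the metric. For a nonempty closed convex set $C\subseteq M_k^m$ and a point $x$, the metric projection $P_Cx$ is the unique point of $C$ nearest to $x$, and the reflection $R_Cx$ is the unique point $z$ obtained by extending the geodesic segment $[x,P_Cx]$ beyond $P_Cx$ so that $P_Cx$ is the midpoint of $[x,z]$, i.e. $d(x,P_Cx)=d(z,P_Cx)=\tfrac12 d(x,z)$ (so $R_Cx=x$ if $x\in C$). $I$ is the identity mapping. *)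

theory Defs
  imports "HOL-Analysis.Analysis"
begin

section \<open>Metric notions on a carrier set M with distance d\<close>

definition geodesic_path ::
    "'a set \<Rightarrow> ('a \<Rightarrow> 'a \<Rightarrow> real) \<Rightarrow> 'a \<Rightarrow> 'a \<Rightarrow> (real \<Rightarrow> 'a) \<Rightarrow> bool" where
  "geodesic_path M d x y c \<longleftrightarrow>
     c ` {0..d x y} \<subseteq> M \<and> c 0 = x \<and> c (d x y) = y \<and>
     (\<forall>s\<in>{0..d x y}. \<forall>t\<in>{0..d x y}. d (c s) (c t) = \<bar>s - t\<bar>)"

definition geodesic_segment ::
    "'a set \<Rightarrow> ('a \<Rightarrow> 'a \<Rightarrow> real) \<Rightarrow> 'a \<Rightarrow> 'a \<Rightarrow> 'a set \<Rightarrow> bool" where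
  "geodesic_segment M d x y S \<longleftrightarrow> (\<exists>c. geodesic_path M d x y c \<and> S = c ` {0..d x y})"

text \<open>In the model spaces below any two points are joined by exactly one geodesic segment,
  so quantifying over all segments is the same as speaking of the segment.\<close>

definition geodesically_convex ::
    "'a set \<Rightarrow> ('a \<Rightarrow> 'a \<Rightarrow> real) \<Rightarrow> 'a set \<Rightarrow> bool" where
  "geodesically_convex M d C \<longleftrightarrow>
     C \<subseteq> M \<and> (\<forall>x\<in>C. \<forall>y\<in>C. \<forall>S. geodesic_segment M d x y S \<longrightarrow> S \<subseteq> C)"

definition is_midpoint ::
    "'a set \<Rightarrow> ('a \<Rightarrow> 'a \<Rightarrow> real) \<Rightarrow> 'a \<Rightarrow> 'a \<Rightarrow> 'a \<Rightarrow> bool" where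
  "is_midpoint M d x y p \<longleftrightarrow> p \<in> M \<and> d x p = d x y / 2 \<and> d y p = d x y / 2"

definition geodesic_midpoint ::
    "'a set \<Rightarrow> ('a \<Rightarrow> 'a \<Rightarrow> real) \<Rightarrow> 'a \<Rightarrow> 'a \<Rightarrow> 'a" where
  "geodesic_midpoint M d x y = (THE p. is_midpoint M d x y p)"

definition metric_projection ::
    "('a \<Rightarrow> 'a \<Rightarrow> real) \<Rightarrow> 'a set \<Rightarrow> 'a \<Rightarrow> 'a" where
  "metric_projection d C x = (THE p. p \<in> C \<and> (\<forall>q\<in>C. d x p \<le> d x q))"

definition metric_reflection ::
    "'a set \<Rightarrow> ('a \<Rightarrow> 'a \<Rightarrow> real) \<Rightarrow> 'a set \<Rightarrow> 'a \<Rightarrow> 'a" where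
  "metric_reflection M d C x =
     (THE z. z \<in> M \<and> is_midpoint M d x z (metric_projection d C x))"

definition aar_map ::
    "'a set \<Rightarrow> ('a \<Rightarrow> 'a \<Rightarrow> real) \<Rightarrow> 'a set \<Rightarrow> 'a set \<Rightarrow> 'a \<Rightarrow> 'a" where
  "aar_map M d A B x =
     geodesic_midpoint M d x (metric_reflection M d A (metric_reflection M d B x))"


section \<open>Model spaces of curvature at most 0\<close>

text \<open>Hyperbolic space is the upper sheet of the hyperboloid in \<open>\<real>\<^sup>m \<times> \<real>\<close>, with
  \<open>cosh (d p q) = - lorentz_form p q\<close>. So that both kinds of model space live in one type,
  Euclidean space is taken to be the slice \<open>\<real>\<^sup>m \<times> {0}\<close>.\<close>

definition lorentz_form :: "(real ^ 'm) \<times> real \<Rightarrow> (real ^ 'm) \<times> real \<Rightarrow> real" where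
  "lorentz_form p q = fst p \<bullet> fst q - snd p * snd q"

definition hyperboloid :: "((real ^ 'm) \<times> real) set" where
  "hyperboloid = {p. lorentz_form p p = -1 \<and> snd p > 0}"

text \<open>The value 0 off the hyperboloid is irrelevant; it is there because the locale
  \<open>Metric_space\<close> asks for nonnegativity and symmetry on the whole type.\<close>

definition hyperbolic_dist :: "(real ^ 'm) \<times> real \<Rightarrow> (real ^ 'm) \<times> real \<Rightarrow> real" where
  "hyperbolic_dist p q =
     (if p \<in> hyperboloid \<and> q \<in> hyperboloid then arcosh (- lorentz_form p q) else 0)"

text \<open>The definitions are only meaningful for \<open>k \<le> 0\<close>.\<close>

definition model_space :: "real \<Rightarrow> ((real ^ 'm) \<times> real) set" where
  "model_space k = (if k = 0 then {p. snd p = 0} else hyperboloid)"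

definition model_dist :: "real \<Rightarrow> (real ^ 'm) \<times> real \<Rightarrow> (real ^ 'm) \<times> real \<Rightarrow> real" where
  "model_dist k p q =
     (if k = 0 then dist (fst p) (fst q) else 1 / sqrt (- k) * hyperbolic_dist p q)"

lemma lorentz_form_simps:
  "lorentz_form (p + q) r = lorentz_form p r + lorentz_form q r"
  "lorentz_form r (p + q) = lorentz_form r p + lorentz_form r q"
  "lorentz_form (c *\<^sub>R p) q = c * lorentz_form p q"
  "lorentz_form p (c *\<^sub>R q) = c * lorentz_form p q"
  by (auto simp: lorentz_form_def algebra_simps)

lemma lorentz_form_commute: "lorentz_form p q = lorentz_form q p"
  by (simp add: lorentz_form_def inner_commute mult.commute)

lemma lorentz_form_orthogonal:
  assumes q: "q \<in> hyperboloid" and orth: "lorentz_form w q = 0"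
  shows "(norm (fst w))\<^sup>2 \<le> (snd q)\<^sup>2 * lorentz_form w w"
proof -
  have t: "(snd q)\<^sup>2 = 1 + (norm (fst q))\<^sup>2"
    using q by (simp add: hyperboloid_def lorentz_form_def dot_square_norm power2_eq_square)
  have "(snd w)\<^sup>2 * (snd q)\<^sup>2 = (fst w \<bullet> fst q)\<^sup>2"
    using orth by (simp add: lorentz_form_def power_mult_distrib)
  also have "\<dots> \<le> (norm (fst w))\<^sup>2 * (norm (fst q))\<^sup>2"
    by (metis Cauchy_Schwarz_ineq dot_square_norm)
  also have "\<dots> = (norm (fst w))\<^sup>2 * (snd q)\<^sup>2 - (norm (fst w))\<^sup>2"
    using t by (simp add: algebra_simps)
  finally show ?thesis
    by (simp add: lorentz_form_def dot_square_norm power2_eq_square algebra_simps)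
qed

lemma lorentz_form_orthogonal_nonneg:
  assumes q: "q \<in> hyperboloid" and orth: "lorentz_form w q = 0"
  shows "0 \<le> lorentz_form w w"
proof -
  have "0 \<le> (snd q)\<^sup>2 * lorentz_form w w"
    using lorentz_form_orthogonal[OF assms] by (meson order_trans zero_le_power2)
  moreover have "(snd q)\<^sup>2 > 0" using q by (simp add: hyperboloid_def)
  ultimately show ?thesis by (simp add: zero_le_mult_iff)
qed

lemma lorentz_form_Cauchy_Schwarz:
  assumes q: "q \<in> hyperboloid" and u: "lorentz_form u q = 0" and v: "lorentz_form v q = 0"
  shows "(lorentz_form u v)\<^sup>2 \<le> lorentz_form u u * lorentz_form v v"
proof -
  let ?a = "lorentz_form u u" and ?b = "lorentz_form u v" and ?c = "lorentz_form v v"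
  have quad: "0 \<le> ?a + 2 * x * ?b + x\<^sup>2 * ?c" for x
  proof -
    have "0 \<le> lorentz_form (u + x *\<^sub>R v) (u + x *\<^sub>R v)"
      by (rule lorentz_form_orthogonal_nonneg[OF q]) (simp add: lorentz_form_simps u v)
    also have "\<dots> = ?a + 2 * x * ?b + x\<^sup>2 * ?c"
      by (simp add: lorentz_form_simps lorentz_form_commute[of v u] power2_eq_square algebra_simps)
    finally show ?thesis .
  qed
  have c: "?c \<ge> 0" by (rule lorentz_form_orthogonal_nonneg[OF q v])
  show ?thesis
  proof (cases "?c = 0")
    case True
    have "?b = 0"
    proof (rule ccontr)
      assume "?b \<noteq> 0"
      then show False
        using quad[of "- (?a + 1) / (2 * ?b)"] True by (simp add: field_simps)
    qed
    then show ?thesis using True by simp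
  next
    case False
    then have "?c > 0" using c by simp
    then show ?thesis
      using quad[of "- ?b / ?c"] by (simp add: field_simps power2_eq_square)
  qed
qed

lemma hyperboloid_lorentz_form:
  assumes p: "p \<in> hyperboloid" and q: "q \<in> hyperboloid"
  shows "- lorentz_form p q \<ge> 1" and "- lorentz_form p q = 1 \<longleftrightarrow> p = q"
proof -
  have pp: "lorentz_form p p = -1" and qq: "lorentz_form q q = -1"
    using p q by (auto simp: hyperboloid_def)
  let ?X = "- lorentz_form p q"
  have norm_less: "norm (fst r) < snd r" if "r \<in> hyperboloid" for r :: "(real ^ 'm) \<times> real"
  proof -
    have "(norm (fst r))\<^sup>2 < (snd r)\<^sup>2"
      using that by (simp add: hyperboloid_def lorentz_form_def dot_square_norm power2_eq_square)
    then show ?thesis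
      using that by (simp add: hyperboloid_def power_less_imp_less_base)
  qed
  have "fst p \<bullet> fst q \<le> norm (fst p) * norm (fst q)" by (rule norm_cauchy_schwarz)
  also have "\<dots> < snd p * snd q"
    by (intro mult_strict_mono' norm_less p q norm_ge_zero)
  finally have pos: "?X > 0" by (simp add: lorentz_form_def)
  let ?w = "p + lorentz_form p q *\<^sub>R q"
  have w: "lorentz_form ?w q = 0" by (simp add: lorentz_form_simps qq)
  have ww: "lorentz_form ?w ?w = ?X\<^sup>2 - 1"
    by (simp add: lorentz_form_simps pp qq lorentz_form_commute[of q p] power2_eq_square)
  have "?X\<^sup>2 \<ge> 1" using lorentz_form_orthogonal_nonneg[OF q w] ww by simp
  then show "?X \<ge> 1" using pos by (intro power2_le_imp_le[of 1 ?X]) simp_all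
  show "?X = 1 \<longleftrightarrow> p = q"
  proof
    assume X: "?X = 1"
    have "fst ?w = 0"
      using lorentz_form_orthogonal[OF q w] ww X by simp
    then have fst_eq: "fst p = fst q" using X by simp
    have "(snd p)\<^sup>2 = (snd q)\<^sup>2"
      using pp qq fst_eq by (simp add: lorentz_form_def power2_eq_square)
    then have "snd p = snd q" using p q by (simp add: hyperboloid_def)
    with fst_eq show "p = q" by (simp add: prod_eq_iff)
  qed (simp add: qq)
qed

lemma hyperbolic_dist_triangle:
  assumes p: "p \<in> hyperboloid" and q: "q \<in> hyperboloid" and r: "r \<in> hyperboloid"
  shows "hyperbolic_dist p r \<le> hyperbolic_dist p q + hyperbolic_dist q r"
proof -
  have pp: "lorentz_form p p = -1" and qq: "lorentz_form q q = -1" and rr: "lorentz_form r r = -1"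
    using p q r by (auto simp: hyperboloid_def)
  note ge1 = hyperboloid_lorentz_form(1)[OF p q] hyperboloid_lorentz_form(1)[OF q r]
    hyperboloid_lorentz_form(1)[OF p r]
  let ?X = "- lorentz_form p q" and ?Y = "- lorentz_form q r"
  let ?u = "p + lorentz_form p q *\<^sub>R q" and ?v = "r + lorentz_form q r *\<^sub>R q"
  note comm = lorentz_form_commute[of q p] lorentz_form_commute[of r q] lorentz_form_commute[of r p]
  have u: "lorentz_form ?u q = 0" "lorentz_form ?u ?u = ?X\<^sup>2 - 1"
    and v: "lorentz_form ?v q = 0" "lorentz_form ?v ?v = ?Y\<^sup>2 - 1"
    and uv: "lorentz_form ?u ?v = lorentz_form p r + ?X * ?Y"
    by (simp_all add: lorentz_form_simps pp qq rr comm power2_eq_square algebra_simps)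
  have "(lorentz_form p r + ?X * ?Y)\<^sup>2 \<le> (?X\<^sup>2 - 1) * (?Y\<^sup>2 - 1)"
    using lorentz_form_Cauchy_Schwarz[OF q u(1) v(1)] u v uv by simp
  then have "\<bar>lorentz_form p r + ?X * ?Y\<bar> \<le> sqrt (?X\<^sup>2 - 1) * sqrt (?Y\<^sup>2 - 1)"
    by (metis real_sqrt_abs real_sqrt_le_mono real_sqrt_mult)
  then have "- lorentz_form p r \<le> ?X * ?Y + sqrt (?X\<^sup>2 - 1) * sqrt (?Y\<^sup>2 - 1)"
    by linarith
  also have "\<dots> = cosh (arcosh ?X + arcosh ?Y)"
    using ge1 by (simp add: cosh_add sinh_arcosh_real)
  finally have le: "- lorentz_form p r \<le> cosh (arcosh ?X + arcosh ?Y)" .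
  have "cosh (arcosh (- lorentz_form p r)) \<le> cosh (arcosh ?X + arcosh ?Y)"
    using le ge1 by simp
  then have "arcosh (- lorentz_form p r) \<le> arcosh ?X + arcosh ?Y"
    using ge1 by (subst (asm) cosh_real_nonneg_le_iff) auto
  then show ?thesis using p q r by (simp add: hyperbolic_dist_def)
qed

lemma Metric_space_model_space:
  assumes "k \<le> 0"
  shows "Metric_space (model_space k) (model_dist k)"
proof (cases "k = 0")
  case True
  then show ?thesis
    by unfold_locales
      (auto simp: model_space_def model_dist_def dist_commute prod_eq_iff dist_triangle)
next
  case False
  then have k: "k < 0" using assms by simp
  show ?thesis
  proof
    fix p q r :: "(real ^ 'm) \<times> real"
    show "0 \<le> model_dist k p q"
      using k hyperboloid_lorentz_form(1)[of p q] by (simp add: model_dist_def hyperbolic_dist_def)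
    show "model_dist k p q = model_dist k q p"
      by (auto simp: model_dist_def hyperbolic_dist_def dist_commute lorentz_form_commute)
    assume pq: "p \<in> model_space k" "q \<in> model_space k"
    then show "model_dist k p q = 0 \<longleftrightarrow> p = q"
      using k hyperboloid_lorentz_form[of p q]
      by (simp add: model_space_def model_dist_def hyperbolic_dist_def)
    assume "r \<in> model_space k"
    with pq show "model_dist k p r \<le> model_dist k p q + model_dist k q r"
      using k hyperbolic_dist_triangle[of p q r]
      by (simp add: model_space_def model_dist_def flip: add_divide_distrib)
         (simp add: divide_right_mono)
  qed
qed

end

theory Submission
  imports Defs
begin

text \<open>Reflections are nonexpansive: if \<open>p\<close>, \<open>q\<close> are the projections of \<open>x\<close>, \<open>y\<close> to a convex set, the
  angles at \<open>p\<close> and \<open>q\<close> are obtuse, and in the hyperboloid model, where \<open>R x = 2 * cosh (d x p) * p - x\<close>,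
  this turns into \<open>cosh (d (R x) (R y)) \<le> cosh (d x y)\<close> by expanding the bilinear form. Hence
  \<open>U = R\<^sub>A R\<^sub>B\<close> is nonexpansive and fixes \<open>A \<inter> B\<close>, and uniform convexity of the distance shows that
  \<open>d (x\<^sub>n) (U x\<^sub>n)\<close> tends to 0 along the averaged iteration. By properness and Fejer monotonicity
  \<open>x\<^sub>n\<close> converges to a fixed point \<open>x\<close> of \<open>U\<close>. Then \<open>P\<^sub>B x\<close> and \<open>P\<^sub>A (R\<^sub>B x)\<close> are both the midpoint of
  \<open>x\<close> and \<open>R\<^sub>B x\<close>, so \<open>P\<^sub>B x \<in> A\<close>; continuity of \<open>P\<^sub>B\<close> gives the claim on the shadow sequence.\<close>

lemma geodesically_convex_mem: "\<lbrakk>geodesically_convex M d C; x \<in> C\<rbrakk> \<Longrightarrow> x \<in> M"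
  by (auto simp only: geodesically_convex_def)

lemma real_tendsto_0_of_le:
  fixes f g :: "nat \<Rightarrow> real"
  assumes "\<And>n. 0 \<le> f n" "\<And>n. f n \<le> g n" "g \<longlonglongrightarrow> 0"
  shows "f \<longlonglongrightarrow> 0"
  by (rule tendsto_sandwich[OF _ _ tendsto_const assms(3)]) (use assms in auto)

section \<open>Averaged alternating reflections in an abstract setting\<close>

text \<open>The predicate under the \<open>THE\<close> of \<open>metric_projection\<close>, kept
  separate so that nearest points can be studied before existence and uniqueness are known.\<close>

definition nearest_point :: "('a \<Rightarrow> 'a \<Rightarrow> real) \<Rightarrow> 'a set \<Rightarrow> 'a \<Rightarrow> 'a \<Rightarrow> bool" where
  "nearest_point d C x p \<longleftrightarrow> p \<in> C \<and> (\<forall>q\<in>C. d x p \<le> d x q)"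

text \<open>The gauge \<open>\<phi>\<close> is \<open>s\<^sup>2\<close> in Euclidean space and \<open>cosh (sqrt (- k) * s)\<close> in hyperbolic space.\<close>

locale reflection_space = Metric_space M d for M :: "'a set" and d +
  fixes \<phi> :: "real \<Rightarrow> real" and c :: real
  assumes geodesic: "\<lbrakk>x \<in> M; y \<in> M\<rbrakk> \<Longrightarrow> \<exists>\<gamma>. geodesic_path M d x y \<gamma>"
    and gauge_strict_mono: "strict_mono_on {0..} \<phi>"
    and gauge_continuous: "continuous_on UNIV \<phi>"
    and modulus_pos: "c > 0"
    and gauge_midpoint: "\<lbrakk>x \<in> M; y \<in> M; z \<in> M; is_midpoint M d x y m\<rbrakk> \<Longrightarrow>
          \<phi> (d m z) + c * (d x y)\<^sup>2 \<le> (\<phi> (d x z) + \<phi> (d y z)) / 2"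
    and bounded_subsequence: "\<lbrakk>range \<sigma> \<subseteq> M; z \<in> M; \<And>n::nat. d (\<sigma> n) z \<le> b\<rbrakk> \<Longrightarrow>
          \<exists>l\<in>M. \<exists>r. strict_mono r \<and> (\<lambda>n. d (\<sigma> (r n)) l) \<longlonglongrightarrow> 0"
    and reflection_ex1: "\<lbrakk>x \<in> M; p \<in> M\<rbrakk> \<Longrightarrow> \<exists>!z. z \<in> M \<and> is_midpoint M d x z p"
    and reflection_nonexpansive:
      "\<lbrakk>geodesically_convex M d C; x \<in> M; y \<in> M; nearest_point d C x p; nearest_point d C y q;
        u \<in> M; v \<in> M; is_midpoint M d x u p; is_midpoint M d y v q\<rbrakk> \<Longrightarrow> d u v \<le> d x y"
begin

section \<open>The gauge and midpoints\<close>

lemma gauge_less: "\<lbrakk>0 \<le> s; s < t\<rbrakk> \<Longrightarrow> \<phi> s < \<phi> t"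
  using gauge_strict_mono by (rule strict_mono_onD) auto

lemma gauge_le_iff: "\<lbrakk>0 \<le> s; 0 \<le> t\<rbrakk> \<Longrightarrow> \<phi> s \<le> \<phi> t \<longleftrightarrow> s \<le> t"
  using gauge_less[of s t] gauge_less[of t s] by (cases s t rule: linorder_cases) auto

lemma gauge_tendsto: "(f \<longlongrightarrow> l) F \<Longrightarrow> ((\<lambda>n. \<phi> (f n)) \<longlongrightarrow> \<phi> l) F"
  using gauge_continuous by (rule continuous_on_tendsto_compose) auto

lemma limitin_sequence_iff:
  assumes "\<And>n::nat. \<sigma> n \<in> M"
  shows "limitin mtopology \<sigma> l sequentially \<longleftrightarrow> l \<in> M \<and> (\<lambda>n. d (\<sigma> n) l) \<longlonglongrightarrow> 0"
  using assms by (simp add: limitin_metric_dist_null)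

lemma geodesic_half_is_midpoint:
  assumes "geodesic_path M d x y \<gamma>"
  shows "is_midpoint M d x y (\<gamma> (d x y / 2))"
proof -
  have I: "0 \<in> {0..d x y}" "d x y / 2 \<in> {0..d x y}" "d x y \<in> {0..d x y}" by auto
  have g: "\<gamma> 0 = x" "\<gamma> (d x y) = y" "\<gamma> (d x y / 2) \<in> M"
    using assms I by (auto simp: geodesic_path_def)
  have "d (\<gamma> 0) (\<gamma> (d x y / 2)) = \<bar>0 - d x y / 2\<bar>" "d (\<gamma> (d x y)) (\<gamma> (d x y / 2)) = \<bar>d x y - d x y / 2\<bar>"
    using assms I unfolding geodesic_path_def by blast+
  then show ?thesis using g by (simp add: is_midpoint_def)
qed

lemma midpoint_ex:
  assumes "x \<in> M" "y \<in> M"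
  shows "\<exists>m. is_midpoint M d x y m"
  using geodesic[OF assms] geodesic_half_is_midpoint by blast

text \<open>If \<open>p\<close> and \<open>q\<close> differed, the strict gap in
  \<open>gauge_midpoint\<close> would put a midpoint of \<open>p\<close> and \<open>q\<close> at
  distance less than \<open>d x y / 2\<close> from both \<open>x\<close> and \<open>y\<close>,
  against the triangle inequality.\<close>

lemma midpoint_unique:
  assumes x: "x \<in> M" and y: "y \<in> M" and p: "is_midpoint M d x y p" and q: "is_midpoint M d x y q"
  shows "p = q"
proof (rule ccontr)
  assume "p \<noteq> q"
  have pq: "p \<in> M" "q \<in> M" using p q by (auto simp: is_midpoint_def)
  obtain m where m: "is_midpoint M d p q m" using midpoint_ex pq by blast
  have mM: "m \<in> M" using m by (auto simp: is_midpoint_def)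
  have "0 < c * (d p q)\<^sup>2"
    using modulus_pos \<open>p \<noteq> q\<close> pq by simp
  then have lt: "d m z < d x y / 2" if "z \<in> M" "d p z = d x y / 2" "d q z = d x y / 2" for z
    using gauge_midpoint[OF pq that(1) m] that gauge_le_iff[of "d x y / 2" "d m z"]
    by (simp add: not_le[symmetric])
  have "d m x < d x y / 2" "d m y < d x y / 2"
    by (rule lt; use x y p q in \<open>simp add: is_midpoint_def commute\<close>)+
  then show False using triangle[OF x mM y] by (simp add: commute)
qed

text \<open>Convexity speaks of geodesic segments, midpoints only of distances; uniqueness
  identifies \<open>m\<close> with the halfway point of a segment.\<close>

lemma convex_midpoint:
  assumes C: "geodesically_convex M d C" and x: "x \<in> C" and y: "y \<in> C"
    and m: "is_midpoint M d x y m"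
  shows "m \<in> C"
proof -
  note xy = geodesically_convex_mem[OF C x] geodesically_convex_mem[OF C y]
  obtain \<gamma> where \<gamma>: "geodesic_path M d x y \<gamma>" using geodesic xy by blast
  then have "\<gamma> ` {0..d x y} \<subseteq> C"
    using C x y unfolding geodesically_convex_def geodesic_segment_def by blast
  then have "\<gamma> (d x y / 2) \<in> C" by (simp add: image_subset_iff)
  then show ?thesis
    using midpoint_unique[OF xy m geodesic_half_is_midpoint[OF \<gamma>]] by simp
qed

section \<open>Nearest points and projections\<close>

text \<open>The midpoint of \<open>q\<close> and \<open>p\<close> lies in \<open>C\<close>, hence is
  no closer to \<open>x\<close> than \<open>p\<close>, and \<open>gauge_midpoint\<close> gives the
  bound. It says that an almost nearest point is close to \<open>p\<close>, which yields both
  uniqueness and continuity of the projection.\<close>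

lemma nearest_point_gap:
  assumes C: "geodesically_convex M d C" and x: "x \<in> M"
    and p: "nearest_point d C x p" and q: "q \<in> C"
  shows "2 * c * (d q p)\<^sup>2 \<le> \<phi> (d x q) - \<phi> (d x p)"
proof -
  have pC: "p \<in> C" using p by (simp add: nearest_point_def)
  note pq = geodesically_convex_mem[OF C pC] geodesically_convex_mem[OF C q]
  obtain m where m: "is_midpoint M d q p m" using midpoint_ex pq by blast
  have "m \<in> C" using convex_midpoint[OF C q pC m] .
  then have "\<phi> (d x p) \<le> \<phi> (d m x)"
    using p gauge_le_iff by (simp add: nearest_point_def commute)
  then show ?thesis
    using gauge_midpoint[OF pq(2,1) x m] by (simp add: commute)
qed

lemma nearest_point_unique:
  assumes C: "geodesically_convex M d C" and x: "x \<in> M"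
    and p: "nearest_point d C x p" and q: "nearest_point d C x q"
  shows "p = q"
proof -
  have eq: "d x p = d x q" and qC: "q \<in> C" and pq: "p \<in> M" "q \<in> M"
    using p q geodesically_convex_mem[OF C] by (auto simp: nearest_point_def intro: antisym)
  have "2 * c * (d q p)\<^sup>2 \<le> 0"
    using nearest_point_gap[OF C x p qC] eq by simp
  then show ?thesis using modulus_pos pq by (simp add: mult_le_0_iff)
qed

text \<open>A minimising sequence is bounded, so a subsequence converges; the limit lies in the
  closed set \<open>C\<close> and attains the infimum.\<close>

lemma nearest_point_ex:
  assumes "C \<noteq> {}" and C: "closedin mtopology C" and x: "x \<in> M"
  shows "\<exists>p. nearest_point d C x p"
proof -
  have CM: "C \<subseteq> M" using C closedin_metric by blast
  define \<delta> where "\<delta> = (INF q\<in>C. d x q)"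
  have bdd: "bdd_below (d x ` C)" by (auto intro: bdd_belowI[of _ 0])
  have "\<exists>q\<in>C. d x q < \<delta> + 1 / Suc n" for n
    using cINF_less_iff[of C "d x" "\<delta> + 1 / Suc n"] assms(1) bdd by (simp add: \<delta>_def)
  then obtain \<sigma> where \<sigma>: "\<And>n. \<sigma> n \<in> C" "\<And>n. d x (\<sigma> n) < \<delta> + 1 / Suc n" by metis
  have \<sigma>M: "\<sigma> n \<in> M" for n using \<sigma> CM by auto
  have "d (\<sigma> n) x \<le> \<delta> + 1" for n
  proof -
    have "1 / real (Suc n) \<le> 1" by simp
    then show ?thesis using \<sigma>(2)[of n] commute[of x] by (smt (verit))
  qed
  then obtain p r where p: "p \<in> M" and r: "strict_mono r" and lim: "(\<lambda>n. d (\<sigma> (r n)) p) \<longlonglongrightarrow> 0"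
    using bounded_subsequence[of \<sigma> x] \<sigma>M x by blast
  have "limitin mtopology (\<lambda>n. \<sigma> (r n)) p sequentially"
    using limitin_sequence_iff[of "\<lambda>n. \<sigma> (r n)"] \<sigma>M p lim by blast
  then have pC: "p \<in> C"
    by (rule limitin_closedin) (use C \<sigma> in auto)
  have "(\<lambda>n. \<delta> + inverse (real (Suc (r n))) + d (\<sigma> (r n)) p) \<longlonglongrightarrow> \<delta> + 0 + 0"
    using LIMSEQ_subseq_LIMSEQ[OF LIMSEQ_inverse_real_of_nat r] lim
    by (intro tendsto_add tendsto_const) (auto simp: o_def)
  moreover have "d x p \<le> \<delta> + inverse (real (Suc (r n))) + d (\<sigma> (r n)) p" for n
    using triangle[OF x \<sigma>M p, of "r n"] \<sigma>(2)[of "r n"] by (simp add: inverse_eq_divide)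
  ultimately have "d x p \<le> \<delta> + 0 + 0"
    by (intro LIMSEQ_le_const) auto
  moreover have "\<delta> \<le> d x q" if "q \<in> C" for q
    unfolding \<delta>_def using cINF_lower[OF bdd that] .
  ultimately show ?thesis using pC unfolding nearest_point_def by force
qed

lemma nearest_point_projection:
  assumes "C \<noteq> {}" "closedin mtopology C" "geodesically_convex M d C" "x \<in> M"
  shows "nearest_point d C x (metric_projection d C x)"
proof -
  have "\<exists>!p. nearest_point d C x p"
    using nearest_point_ex[of C x] nearest_point_unique[of C x] assms by blast
  then show ?thesis
    unfolding metric_projection_def nearest_point_def[symmetric] by (rule theI')
qed

text \<open>The projection of \<open>\<sigma> n\<close> is an almost nearest point for
  \<open>x\<close>: its distance from \<open>x\<close> exceeds the minimum by at most
  \<open>2 * d (\<sigma> n) x\<close>. Then \<open>nearest_point_gap\<close> at \<open>x\<close>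
  applies.\<close>

lemma projection_tendsto:
  assumes C: "C \<noteq> {}" "closedin mtopology C" "geodesically_convex M d C"
    and \<sigma>: "\<And>n. \<sigma> n \<in> M" and x: "x \<in> M" and lim: "(\<lambda>n. d (\<sigma> n) x) \<longlonglongrightarrow> 0"
  shows "(\<lambda>n. d (metric_projection d C (\<sigma> n)) (metric_projection d C x)) \<longlonglongrightarrow> 0"
proof -
  let ?P = "metric_projection d C"
  have P: "nearest_point d C y (?P y)" if "y \<in> M" for y
    using nearest_point_projection[OF C that] .
  have CM: "C \<subseteq> M" using C closedin_metric by blast
  have PC: "?P y \<in> C" and PM: "?P y \<in> M" if "y \<in> M" for y
    using P[OF that] CM by (auto simp: nearest_point_def)
  have bound: "2 * c * (d (?P (\<sigma> n)) (?P x))\<^sup>2 \<le> \<phi> (d x (?P x) + 2 * d (\<sigma> n) x) - \<phi> (d x (?P x))" for n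
  proof -
    have "d (\<sigma> n) (?P (\<sigma> n)) \<le> d (\<sigma> n) (?P x)"
      using P[OF \<sigma>] PC[OF x] by (simp add: nearest_point_def)
    also have "\<dots> \<le> d (\<sigma> n) x + d x (?P x)" by (intro triangle \<sigma> x PM)
    finally have "d x (?P (\<sigma> n)) \<le> d x (?P x) + 2 * d (\<sigma> n) x"
      using triangle[OF x \<sigma> PM[OF \<sigma>], of n n] by (simp add: commute)
    then have "\<phi> (d x (?P (\<sigma> n))) \<le> \<phi> (d x (?P x) + 2 * d (\<sigma> n) x)"
      by (subst gauge_le_iff) auto
    then show ?thesis
      using nearest_point_gap[OF C(3) x P[OF x] PC[OF \<sigma>], of n] by linarith
  qed
  have "(\<lambda>n. \<phi> (d x (?P x) + 2 * d (\<sigma> n) x) - \<phi> (d x (?P x))) \<longlonglongrightarrow>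
      \<phi> (d x (?P x) + 2 * 0) - \<phi> (d x (?P x))"
    by (intro tendsto_diff gauge_tendsto tendsto_add tendsto_mult tendsto_const lim)
  then have "(\<lambda>n. 2 * c * (d (?P (\<sigma> n)) (?P x))\<^sup>2) \<longlonglongrightarrow> 0"
    by (intro real_tendsto_0_of_le[OF _ bound]) (use modulus_pos in auto)
  then have "(\<lambda>n. inverse (2 * c) * (2 * c * (d (?P (\<sigma> n)) (?P x))\<^sup>2)) \<longlonglongrightarrow> 0"
    by (rule tendsto_mult_right_zero)
  then have "(\<lambda>n. (d (?P (\<sigma> n)) (?P x))\<^sup>2) \<longlonglongrightarrow> 0"
    using modulus_pos by (simp add: field_simps)
  then show ?thesis by simp
qed

section \<open>Reflections\<close>

lemma reflection_is_midpoint: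
  assumes "C \<noteq> {}" "closedin mtopology C" "geodesically_convex M d C" "x \<in> M"
  shows "metric_reflection M d C x \<in> M \<and>
    is_midpoint M d x (metric_reflection M d C x) (metric_projection d C x)"
proof -
  have "metric_projection d C x \<in> M"
    using nearest_point_projection[OF assms] geodesically_convex_mem[OF assms(3)]
    by (simp add: nearest_point_def)
  then show ?thesis
    unfolding metric_reflection_def by (rule theI'[OF reflection_ex1[OF assms(4)]])
qed

lemma metric_reflection_nonexpansive:
  assumes "C \<noteq> {}" "closedin mtopology C" "geodesically_convex M d C" "x \<in> M" "y \<in> M"
  shows "d (metric_reflection M d C x) (metric_reflection M d C y) \<le> d x y"
  using reflection_is_midpoint[OF assms(1-4)] reflection_is_midpoint[OF assms(1-3,5)]
  by (elim conjE)
    (rule reflection_nonexpansive[OF assms(3-5) nearest_point_projection[OF assms(1-4)]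
        nearest_point_projection[OF assms(1-3,5)]])

text \<open>Here the projection is \<open>x\<close> itself, and \<open>x\<close> is a midpoint of
  \<open>x\<close> and \<open>x\<close>. This makes every common point of the two sets a fixed point
  of the composed reflections.\<close>

lemma metric_reflection_of_mem:
  assumes C: "C \<noteq> {}" "closedin mtopology C" "geodesically_convex M d C" and x: "x \<in> C"
  shows "metric_reflection M d C x = x"
proof -
  note xM = geodesically_convex_mem[OF C(3) x]
  have "nearest_point d C x x" using x xM by (simp add: nearest_point_def)
  then have P: "metric_projection d C x = x"
    using nearest_point_unique nearest_point_projection C xM by blast
  have "is_midpoint M d x x x" using xM by (simp add: is_midpoint_def)
  then show ?thesis
    using reflection_ex1[OF xM xM] reflection_is_midpoint[OF C xM] xM
    unfolding P by metis
qed

section \<open>Averaged iterations\<close>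

lemma geodesic_midpoint_is_midpoint:
  assumes "x \<in> M" "y \<in> M"
  shows "is_midpoint M d x y (geodesic_midpoint M d x y)"
  unfolding geodesic_midpoint_def
  by (rule theI'[OF ex_ex1I[OF midpoint_ex[OF assms] midpoint_unique[OF assms]]])

text \<open>A Krasnoselskii--Mann argument. The gap in the midpoint inequality makes the displacements
  \<open>d (x\<^sub>n) (U x\<^sub>n)\<close> square summable, so cluster points are fixed points of \<open>U\<close>; Fejer
  monotonicity with respect to a cluster point upgrades it to the limit.\<close>

lemma averaged_iteration_converges:
  assumes UM: "\<And>x. x \<in> M \<Longrightarrow> U x \<in> M"
    and U: "\<And>x y. \<lbrakk>x \<in> M; y \<in> M\<rbrakk> \<Longrightarrow> d (U x) (U y) \<le> d x y"
    and z: "z \<in> M" "U z = z" and x0: "x\<^sub>0 \<in> M"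
  defines "T \<equiv> \<lambda>x. geodesic_midpoint M d x (U x)"
  shows "\<exists>x\<in>M. U x = x \<and> (\<lambda>n. d ((T ^^ n) x\<^sub>0) x) \<longlonglongrightarrow> 0"
proof -
  let ?x = "\<lambda>n. (T ^^ n) x\<^sub>0"
  have mid: "is_midpoint M d x (U x) (T x)" if "x \<in> M" for x
    unfolding T_def by (rule geodesic_midpoint_is_midpoint[OF that UM[OF that]])
  have TM: "T x \<in> M" if "x \<in> M" for x using mid[OF that] by (simp add: is_midpoint_def)
  have xM: "?x n \<in> M" for n by (induction n) (auto intro: x0 TM)
  \<comment> \<open>As \<open>w\<close> is fixed, nonexpansiveness bounds both gauge values averaged
    in \<open>gauge_midpoint\<close> by the one at the current iterate. Fejer monotonicity and the
    vanishing of the displacements both come from this.\<close>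
  have step: "\<phi> (d (?x (Suc n)) w) + c * (d (?x n) (U (?x n)))\<^sup>2 \<le> \<phi> (d (?x n) w)"
    if "w \<in> M" "U w = w" for w n
  proof -
    have "\<phi> (d (U (?x n)) w) \<le> \<phi> (d (?x n) w)"
      using U[OF xM that(1), of n] that by (simp add: gauge_le_iff)
    then show ?thesis
      using gauge_midpoint[OF xM UM[OF xM] that(1) mid[OF xM], of n] by simp
  qed
  have dec: "decseq (\<lambda>n. d (?x n) w)" if "w \<in> M" "U w = w" for w
  proof (rule decseq_SucI)
    fix n
    have "0 \<le> c * (d (?x n) (U (?x n)))\<^sup>2" using modulus_pos by simp
    then have "\<phi> (d (?x (Suc n)) w) \<le> \<phi> (d (?x n) w)" using step[OF that, of n] by linarith
    then show "d (?x (Suc n)) w \<le> d (?x n) w" by (simp add: gauge_le_iff)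
  qed
  \<comment> \<open>Convergence of the distances to \<open>z\<close> suffices: consecutive
    differences of the gauge values tend to 0, and by \<open>step\<close> they dominate
    \<open>c\<close> times the squared displacement.\<close>
  obtain L where "(\<lambda>n. d (?x n) z) \<longlonglongrightarrow> L"
    using decseq_convergent[OF dec[OF z], of 0] by auto
  then have \<phi>L: "(\<lambda>n. \<phi> (d (?x n) z)) \<longlonglongrightarrow> \<phi> L" by (rule gauge_tendsto)
  have "(\<lambda>n. \<phi> (d (?x n) z) - \<phi> (d (?x (Suc n)) z)) \<longlonglongrightarrow> \<phi> L - \<phi> L"
    by (intro tendsto_diff \<phi>L LIMSEQ_Suc[OF \<phi>L])
  then have "(\<lambda>n. (\<phi> (d (?x n) z) - \<phi> (d (?x (Suc n)) z)) / c) \<longlonglongrightarrow> 0"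
    by (intro tendsto_divide_zero) simp
  then have "(\<lambda>n. (d (?x n) (U (?x n)))\<^sup>2) \<longlonglongrightarrow> 0"
    by (rule real_tendsto_0_of_le[rotated 2])
      (use step[OF z] modulus_pos in \<open>auto simp: field_simps add_increasing2\<close>)
  then have disp: "(\<lambda>n. d (?x n) (U (?x n))) \<longlonglongrightarrow> 0"
    by simp
  have "d (?x n) z \<le> d x\<^sub>0 z" for n
    using decseqD[OF dec[OF z], of 0 n] by simp
  then obtain x r where x: "x \<in> M" and r: "strict_mono r" and lim: "(\<lambda>n. d (?x (r n)) x) \<longlonglongrightarrow> 0"
    using bounded_subsequence[of ?x z] xM z by blast
  have "(\<lambda>n. 2 * d (?x (r n)) x + d (?x (r n)) (U (?x (r n)))) \<longlonglongrightarrow> 2 * 0 + 0"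
    using LIMSEQ_subseq_LIMSEQ[OF disp r] lim
    by (intro tendsto_add tendsto_mult tendsto_const) (auto simp: o_def)
  \<comment> \<open>Go from \<open>x\<close> to \<open>U x\<close> through an iterate and its image;
    nonexpansiveness bounds the last leg by the first.\<close>
  moreover have "d x (U x) \<le> 2 * d (?x (r n)) x + d (?x (r n)) (U (?x (r n)))" for n
    using triangle[OF x xM UM[OF x], of "r n"] triangle[OF xM UM[OF xM] UM[OF x], of "r n" "r n"]
      U[OF xM x, of "r n"] commute[of x "?x (r n)"] by linarith
  ultimately have "d x (U x) \<le> 2 * 0 + 0" by (intro LIMSEQ_le_const) auto
  then have Ux: "U x = x" using x UM zero[of x "U x"] nonneg[of x "U x"] by auto
  obtain L' where L': "(\<lambda>n. d (?x n) x) \<longlonglongrightarrow> L'"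
    using decseq_convergent[OF dec[OF x Ux], of 0] by auto
  have "L' = 0"
    using LIMSEQ_unique[OF LIMSEQ_subseq_LIMSEQ[OF L' r]] lim by (simp add: o_def)
  then show ?thesis using x Ux L' by blast
qed

theorem averaged_alternating_reflections:
  assumes A: "A \<noteq> {}" "closedin mtopology A" "geodesically_convex M d A"
    and B: "B \<noteq> {}" "closedin mtopology B" "geodesically_convex M d B"
    and AB: "A \<inter> B \<noteq> {}" and x0: "x\<^sub>0 \<in> M"
  defines "T \<equiv> aar_map M d A B" and "P \<equiv> metric_projection d B"
  shows "(\<exists>x\<in>M. T x = x \<and> limitin mtopology (\<lambda>n. (T ^^ n) x\<^sub>0) x sequentially \<and> P x \<in> A \<inter> B) \<and>
    (\<exists>y\<in>A \<inter> B. limitin mtopology (\<lambda>n. P ((T ^^ n) x\<^sub>0)) y sequentially)"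
proof -
  let ?RA = "metric_reflection M d A" and ?RB = "metric_reflection M d B"
  define U where "U x = ?RA (?RB x)" for x
  note RA = reflection_is_midpoint[OF A] and RB = reflection_is_midpoint[OF B]
  have T: "T = (\<lambda>x. geodesic_midpoint M d x (U x))"
    by (simp add: T_def U_def aar_map_def fun_eq_iff)
  have UM: "U x \<in> M" if "x \<in> M" for x using RA RB that by (simp add: U_def)
  have U: "d (U x) (U y) \<le> d x y" if "x \<in> M" "y \<in> M" for x y
    unfolding U_def
    by (rule order_trans[OF metric_reflection_nonexpansive[OF A] metric_reflection_nonexpansive[OF B]])
      (use RB that in auto)
  obtain z where z: "z \<in> A" "z \<in> B" using AB by blast
  then have zM: "z \<in> M" and Uz: "U z = z"
    using geodesically_convex_mem[OF A(3)] metric_reflection_of_mem[OF A] metric_reflection_of_mem[OF B]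
    by (auto simp: U_def)
  obtain x where x: "x \<in> M" "U x = x" and lim: "(\<lambda>n. d ((T ^^ n) x\<^sub>0) x) \<longlonglongrightarrow> 0"
    using averaged_iteration_converges[OF UM U zM Uz x0] unfolding T by blast
  have TM: "T y \<in> M" if "y \<in> M" for y
    using geodesic_midpoint_is_midpoint[OF that UM[OF that]] by (simp add: T is_midpoint_def)
  have xM: "(T ^^ n) x\<^sub>0 \<in> M" for n by (induction n) (auto intro: x0 TM)
  have PM: "P y \<in> M" and PB: "P y \<in> B" if "y \<in> M" for y
    using nearest_point_projection[OF B that] geodesically_convex_mem[OF B(3)]
    by (auto simp: P_def nearest_point_def)
  have "is_midpoint M d x x x" using x by (simp add: is_midpoint_def)
  then have Tx: "T x = x"
    using midpoint_unique[OF x(1) x(1)] geodesic_midpoint_is_midpoint[OF x(1) x(1)] x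
    by (simp add: T)
  have y: "?RB x \<in> M" "is_midpoint M d x (?RB x) (P x)" using RB[OF x(1)] by (auto simp: P_def)
  \<comment> \<open>Since \<open>U x = x\<close>, the reflection in \<open>A\<close> carries
    \<open>?RB x\<close> back to \<open>x\<close>; the midpoint relation is read with its end points
    swapped.\<close>
  have "is_midpoint M d x (?RB x) (metric_projection d A (?RB x))"
    using RA[OF y(1)] x(2) by (auto simp: U_def is_midpoint_def commute)
  then have "P x = metric_projection d A (?RB x)"
    using midpoint_unique[OF x(1) y] by simp
  then have PA: "P x \<in> A"
    using nearest_point_projection[OF A y(1)] by (simp add: nearest_point_def)
  have "(\<lambda>n. d (P ((T ^^ n) x\<^sub>0)) (P x)) \<longlonglongrightarrow> 0"
    unfolding P_def by (rule projection_tendsto[OF B xM x(1) lim])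
  then have "limitin mtopology (\<lambda>n. P ((T ^^ n) x\<^sub>0)) (P x) sequentially"
    using limitin_sequence_iff[of "\<lambda>n. P ((T ^^ n) x\<^sub>0)"] PM xM x by blast
  moreover have "limitin mtopology (\<lambda>n. (T ^^ n) x\<^sub>0) x sequentially"
    using limitin_sequence_iff[of "\<lambda>n. (T ^^ n) x\<^sub>0"] xM x lim by blast
  ultimately show ?thesis using x Tx PA PB[OF x(1)] by blast
qed

end

section \<open>Euclidean space\<close>

lemma model_dist_0:
  assumes "p \<in> model_space 0" "q \<in> model_space 0"
  shows "model_dist 0 p q = dist p q"
  using assms by (simp add: model_space_def model_dist_def dist_prod_def)

text \<open>By the parallelogram law for \<open>x - m\<close> and \<open>y - m\<close>, whose
  difference is \<open>x - y\<close>, the norm of their sum is 0.\<close>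

lemma midpoint_of_dist_eq:
  fixes x y m :: "'a :: real_inner"
  assumes "dist x m = dist x y / 2" "dist y m = dist x y / 2"
  shows "m = midpoint x y"
proof -
  have "(norm (x - m))\<^sup>2 = (norm (x - y) / 2)\<^sup>2" "(norm (y - m))\<^sup>2 = (norm (x - y) / 2)\<^sup>2"
    using assms by (simp_all add: dist_norm)
  then have "(norm (x + y - 2 *\<^sub>R m))\<^sup>2 = 0"
    unfolding power_divide power2_norm_eq_inner
    by (simp add: inner_commute inner_simps field_simps)
  then have "x + y = 2 *\<^sub>R m" by simp
  then show ?thesis by (simp add: midpoint_def)
qed

lemma euclidean_is_midpoint_iff:
  fixes x y :: "(real ^ 'm) \<times> real"
  assumes "x \<in> model_space 0" "y \<in> model_space 0"
  shows "is_midpoint (model_space 0) (model_dist 0) x y m \<longleftrightarrow> m = midpoint x y"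
proof
  assume "is_midpoint (model_space 0) (model_dist 0) x y m"
  then show "m = midpoint x y"
    using assms by (intro midpoint_of_dist_eq) (auto simp: is_midpoint_def model_dist_0)
next
  assume "m = midpoint x y"
  moreover have "midpoint x y \<in> model_space 0"
    using assms by (simp add: model_space_def midpoint_def)
  ultimately show "is_midpoint (model_space 0) (model_dist 0) x y m"
    using assms by (simp add: is_midpoint_def model_dist_0 dist_midpoint)
qed

lemma euclidean_geodesic_path:
  fixes x y :: "(real ^ 'm) \<times> real"
  assumes x: "x \<in> model_space 0" and y: "y \<in> model_space 0"
  shows "geodesic_path (model_space 0) (model_dist 0) x y (\<lambda>s. x + (s / dist x y) *\<^sub>R (y - x))"
    (is "geodesic_path _ _ _ _ ?\<gamma>")
proof -
  have M: "?\<gamma> s \<in> model_space 0" for s using x y by (simp add: model_space_def)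
  have "dist (?\<gamma> s) (?\<gamma> t) = \<bar>s - t\<bar>" if "{s, t} \<subseteq> {0..dist x y}" for s t
  proof -
    have "?\<gamma> s - ?\<gamma> t = ((s - t) / dist x y) *\<^sub>R (y - x)"
      by (simp add: diff_divide_distrib scaleR_left_diff_distrib)
    \<comment> \<open>For \<open>x = y\<close> the quotient by \<open>dist x y\<close> is 0 by
      convention, and the parameter interval is the single point 0.\<close>
    then show ?thesis
      using that by (cases "x = y") (auto simp: dist_norm norm_minus_commute)
  qed
  then show ?thesis
    using M x y by (auto simp: geodesic_path_def model_dist_0[OF x y] model_dist_0[OF M M])
qed

text \<open>At an acute angle, a small move from \<open>p\<close> towards \<open>q\<close> would
  come closer to \<open>x\<close> while staying on a segment inside \<open>C\<close>.\<close>

lemma euclidean_nearest_point_inner_le: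
  fixes x p q :: "(real ^ 'm) \<times> real"
  assumes C: "geodesically_convex (model_space 0) (model_dist 0) C" and x: "x \<in> model_space 0"
    and p: "nearest_point (model_dist 0) C x p" and q: "q \<in> C"
  shows "(x - p) \<bullet> (q - p) \<le> 0"
proof (rule ccontr)
  assume "\<not> (x - p) \<bullet> (q - p) \<le> 0"
  then obtain t where t: "t > 0" "t \<le> 1" "dist (p + t *\<^sub>R (q - p)) x < dist p x"
    using closer_point_lemma[of x p q] by auto
  have pC: "p \<in> C" using p by (simp add: nearest_point_def)
  note pM = geodesically_convex_mem[OF C pC] and qM = geodesically_convex_mem[OF C q]
  have "p \<noteq> q" using t by auto
  let ?\<gamma> = "\<lambda>s. p + (s / dist p q) *\<^sub>R (q - p)"
  have "?\<gamma> ` {0..model_dist 0 p q} \<subseteq> C"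
    using C pC q euclidean_geodesic_path[OF pM qM]
    unfolding geodesically_convex_def geodesic_segment_def by blast
  \<comment> \<open>The geodesic is parametrised by arc length, so the affine parameter
    \<open>t\<close> corresponds to \<open>t * dist p q\<close>.\<close>
  moreover have "t * dist p q \<in> {0..model_dist 0 p q}"
    using t model_dist_0[OF pM qM] by (simp add: mult_left_le_one_le)
  ultimately have "?\<gamma> (t * dist p q) \<in> C" by blast
  then have c: "p + t *\<^sub>R (q - p) \<in> C" using \<open>p \<noteq> q\<close> by simp
  then have "model_dist 0 x p \<le> model_dist 0 x (p + t *\<^sub>R (q - p))"
    using p by (auto simp: nearest_point_def)
  then show False
    using t model_dist_0[OF x pM] model_dist_0[OF x geodesically_convex_mem[OF C c]]
    by (simp add: dist_commute)
qed

text \<open>The squared norms differ by exactly four times the sum of the two inner products assumed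
  nonpositive.\<close>

lemma norm_reflection_diff_le:
  fixes x y p q :: "'a :: real_inner"
  assumes "(x - p) \<bullet> (q - p) \<le> 0" "(y - q) \<bullet> (p - q) \<le> 0"
  shows "norm ((2 *\<^sub>R p - x) - (2 *\<^sub>R q - y)) \<le> norm (x - y)"
proof -
  have "(norm ((2 *\<^sub>R p - x) - (2 *\<^sub>R q - y)))\<^sup>2
      = (norm (x - y))\<^sup>2 + 4 * ((x - p) \<bullet> (q - p) + (y - q) \<bullet> (p - q))"
    unfolding power2_norm_eq_inner by (simp add: inner_commute inner_simps algebra_simps)
  also have "\<dots> \<le> (norm (x - y))\<^sup>2" using assms by simp
  finally show ?thesis by simp
qed

text \<open>For squared distances the midpoint inequality is the median formula of Apollonius, an
  equality with constant \<open>1 / 4\<close>.\<close>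

lemma reflection_space_euclidean:
  "reflection_space (model_space 0 :: ((real ^ 'm) \<times> real) set) (model_dist 0) (\<lambda>s. s\<^sup>2) (1 / 4)"
proof -
  let ?M = "model_space 0 :: ((real ^ 'm) \<times> real) set" and ?d = "model_dist 0"
  interpret Metric_space ?M ?d by (rule Metric_space_model_space) simp
  show ?thesis
  proof
    show "strict_mono_on {0::real..} (\<lambda>s. s\<^sup>2)"
      by (auto intro!: strict_mono_onI power_strict_mono)
    show "continuous_on UNIV (\<lambda>s::real. s\<^sup>2)" by (intro continuous_intros)
  next
    fix x y :: "(real ^ 'm) \<times> real"
    assume x: "x \<in> ?M" and y: "y \<in> ?M"
    then show "\<exists>\<gamma>. geodesic_path ?M ?d x y \<gamma>"
      using euclidean_geodesic_path by blast
    fix z m :: "(real ^ 'm) \<times> real"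
    assume z: "z \<in> ?M" and m: "is_midpoint ?M ?d x y m"
    have m': "m = (1/2) *\<^sub>R (x + y)"
      using m euclidean_is_midpoint_iff[OF x y] by (simp add: midpoint_def)
    have "?d m z = dist m z"
      using m z by (intro model_dist_0) (auto simp: is_midpoint_def)
    moreover have "(dist m z)\<^sup>2 + 1/4 * (dist x y)\<^sup>2 = ((dist x z)\<^sup>2 + (dist y z)\<^sup>2) / 2"
      unfolding m' dist_norm power2_norm_eq_inner
      by (simp add: inner_commute inner_simps field_simps)
    ultimately show "(?d m z)\<^sup>2 + 1/4 * (?d x y)\<^sup>2 \<le> ((?d x z)\<^sup>2 + (?d y z)\<^sup>2) / 2"
      using x y z by (simp add: model_dist_0)
  next
    fix \<sigma> :: "nat \<Rightarrow> (real ^ 'm) \<times> real" and z b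
    assume \<sigma>: "range \<sigma> \<subseteq> ?M" and z: "z \<in> ?M" and b: "\<And>n. ?d (\<sigma> n) z \<le> b"
    have "\<sigma> n \<in> cball z b" for n
      using b[of n] \<sigma> z by (simp add: model_dist_0 dist_commute range_subsetD)
    then obtain l r where r: "strict_mono r" and lim: "(\<sigma> \<circ> r) \<longlonglongrightarrow> l"
      using compact_cball[of z b] unfolding compact_def by metis
    have "closed ?M" by (simp add: model_space_def closed_Collect_eq continuous_on_snd)
    then have l: "l \<in> ?M"
      by (rule closed_sequentially[OF _ _ lim]) (use \<sigma> in auto)
    have "(\<lambda>n. dist (\<sigma> (r n)) l) \<longlonglongrightarrow> 0"
      using iffD1[OF tendsto_dist_iff lim] by (simp add: o_def)
    moreover have "?d (\<sigma> (r n)) l = dist (\<sigma> (r n)) l" for n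
      using \<sigma> l by (intro model_dist_0) auto
    ultimately show "\<exists>l\<in>?M. \<exists>r. strict_mono r \<and> (\<lambda>n. ?d (\<sigma> (r n)) l) \<longlonglongrightarrow> 0"
      using l r by (intro bexI[of _ l] exI[of _ r]) simp_all
  next
    fix x p :: "(real ^ 'm) \<times> real"
    assume x: "x \<in> ?M" and p: "p \<in> ?M"
    have "p = midpoint x z \<longleftrightarrow> z = 2 *\<^sub>R p - x" for z :: "(real ^ 'm) \<times> real"
      using midpoint_eq_iff[of x z p] by (auto simp: algebra_simps scaleR_2)
    moreover have "2 *\<^sub>R p - x \<in> ?M" using x p by (simp add: model_space_def)
    ultimately show "\<exists>!z. z \<in> ?M \<and> is_midpoint ?M ?d x z p"
      using euclidean_is_midpoint_iff[OF x] by (intro ex1I[of _ "2 *\<^sub>R p - x"]) (simp, elim conjE, simp)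
  next
    fix C and x y p q u v :: "(real ^ 'm) \<times> real"
    assume C: "geodesically_convex ?M ?d C" and x: "x \<in> ?M" and y: "y \<in> ?M"
      and p: "nearest_point ?d C x p" and q: "nearest_point ?d C y q"
      and u: "u \<in> ?M" and v: "v \<in> ?M" and up: "is_midpoint ?M ?d x u p" and vq: "is_midpoint ?M ?d y v q"
    have "p = midpoint x u" "q = midpoint y v"
      using up vq x y u v by (simp_all add: euclidean_is_midpoint_iff)
    then have "u = 2 *\<^sub>R p - x" "v = 2 *\<^sub>R q - y"
      by (simp_all add: midpoint_def)
    moreover have "(x - p) \<bullet> (q - p) \<le> 0"
      using q by (intro euclidean_nearest_point_inner_le[OF C x p]) (simp add: nearest_point_def)
    moreover have "(y - q) \<bullet> (p - q) \<le> 0"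
      using p by (intro euclidean_nearest_point_inner_le[OF C y q]) (simp add: nearest_point_def)
    ultimately have "dist u v \<le> dist x y"
      using norm_reflection_diff_le unfolding dist_norm by blast
    then show "?d u v \<le> ?d x y" using x y u v by (simp add: model_dist_0)
  qed simp
qed

section \<open>Hyperbolic space\<close>

text \<open>From \<open>s \<le> sinh s\<close> for nonnegative \<open>s\<close> and
  \<open>cosh t = 1 + 2 * (sinh (t / 2))\<^sup>2\<close>. It supplies the quadratic gap in the
  hyperbolic midpoint inequality.\<close>

lemma cosh_ge_quadratic: "1 + t\<^sup>2 / 2 \<le> cosh t" for t :: real
proof -
  have sinh_ge: "s \<le> sinh s" if "s \<ge> 0" for s :: real
  proof -
    have "sinh 0 - 0 \<le> sinh s - s"
      by (rule DERIV_nonneg_imp_nondecreasing[OF that, of "\<lambda>x. sinh x - x"])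
        (auto intro!: derivative_eq_intros simp: cosh_real_ge_1)
    then show ?thesis by simp
  qed
  have "(\<bar>t\<bar> / 2)\<^sup>2 \<le> (sinh (\<bar>t\<bar> / 2))\<^sup>2"
    using sinh_ge[of "\<bar>t\<bar> / 2"] by (intro power_mono) auto
  moreover have "cosh \<bar>t\<bar> = 1 + 2 * (sinh (\<bar>t\<bar> / 2))\<^sup>2"
    using cosh_double_cosh[of "\<bar>t\<bar> / 2"] by (simp add: cosh_square_eq)
  ultimately show ?thesis by (simp add: power_divide)
qed

section \<open>The Lorentz form and the hyperboloid\<close>

lemma hyperboloid_lorentz_form_self: "p \<in> hyperboloid \<Longrightarrow> lorentz_form p p = -1"
  by (simp add: hyperboloid_def)

lemma lorentz_form_diff_minus:
  "lorentz_form (p - q) r = lorentz_form p r - lorentz_form q r"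
  "lorentz_form r (p - q) = lorentz_form r p - lorentz_form r q"
  "lorentz_form (- p) r = - lorentz_form p r"
  "lorentz_form r (- p) = - lorentz_form r p"
  by (auto simp: lorentz_form_def algebra_simps)

text \<open>A vector of square -1 lies on one of the two sheets. On the lower one,
  \<open>- w\<close> would be on the hyperboloid and \<open>lorentz_form w p\<close> at least
  1.\<close>

lemma hyperboloidI:
  assumes w: "lorentz_form w w = -1" and p: "p \<in> hyperboloid" and wp: "lorentz_form w p < 0"
  shows "w \<in> hyperboloid"
proof (rule ccontr)
  assume not: "w \<notin> hyperboloid"
  have "snd w \<noteq> 0"
  proof
    assume "snd w = 0"
    then have "lorentz_form w w \<ge> 0" by (simp add: lorentz_form_def)
    then show False using w by simp
  qed
  then have "- w \<in> hyperboloid"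
    using not w by (auto simp: hyperboloid_def lorentz_form_diff_minus)
  then show False
    using hyperboloid_lorentz_form(1)[OF _ p, of "- w"] wp by (simp add: lorentz_form_diff_minus)
qed

text \<open>The form is positive definite on the orthogonal complement of \<open>q\<close>. Vector
  identities can thus be proved by evaluating the form.\<close>

lemma lorentz_form_null_imp_zero:
  assumes q: "q \<in> hyperboloid" and "lorentz_form w q = 0" "lorentz_form w w = 0"
  shows "w = 0"
proof -
  have "fst w = 0" using lorentz_form_orthogonal[OF assms(1,2)] assms(3) by simp
  moreover have "snd q > 0" using q by (simp add: hyperboloid_def)
  ultimately show ?thesis using assms(2) by (simp add: lorentz_form_def prod_eq_iff)
qed

text \<open>The formula is the linear isometry of the Lorentz form that fixes \<open>p\<close> and
  negates its orthogonal complement, that is, the point reflection at \<open>p\<close>.\<close>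

lemma hyperbolic_reflection_mem:
  assumes x: "x \<in> hyperboloid" and p: "p \<in> hyperboloid"
  shows "- (2 * lorentz_form x p) *\<^sub>R p - x \<in> hyperboloid"
  using hyperboloid_lorentz_form(1)[OF x p] hyperboloid_lorentz_form_self[OF x]
    hyperboloid_lorentz_form_self[OF p]
  by (intro hyperboloidI[OF _ p])
    (auto simp: lorentz_form_simps lorentz_form_diff_minus lorentz_form_commute[of p x])

context
  fixes k :: real
  assumes k: "k < 0"
begin

lemma model_space_neg: "model_space k = hyperboloid"
  using k by (simp add: model_space_def)

lemma sqrt_curvature_pos: "sqrt (- k) > 0"
  using k by simp

lemma hyperbolic_Metric_space: "Metric_space hyperboloid (model_dist k)"
  using Metric_space_model_space[of k] k by (simp add: model_space_neg)

interpretation H: Metric_space hyperboloid "model_dist k"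
  by (rule hyperbolic_Metric_space)

section \<open>Distances, midpoints, geodesics and nearest points on the hyperboloid\<close>

lemma cosh_model_dist:
  assumes "p \<in> hyperboloid" "q \<in> hyperboloid"
  shows "cosh (sqrt (- k) * model_dist k p q) = - lorentz_form p q"
  using assms k hyperboloid_lorentz_form(1)[OF assms]
  by (simp add: model_dist_def hyperbolic_dist_def)

lemma model_dist_le_iff:
  assumes "p \<in> hyperboloid" "q \<in> hyperboloid" "0 \<le> t"
  shows "model_dist k p q \<le> t \<longleftrightarrow> - lorentz_form p q \<le> cosh (sqrt (- k) * t)"
  using assms sqrt_curvature_pos cosh_model_dist[OF assms(1,2)]
    cosh_real_nonneg_le_iff[of "sqrt (- k) * model_dist k p q" "sqrt (- k) * t"]
  by (simp add: mult_le_cancel_left)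

lemma model_dist_eqI:
  assumes "p \<in> hyperboloid" "q \<in> hyperboloid" "0 \<le> t" "- lorentz_form p q = cosh (sqrt (- k) * t)"
  shows "model_dist k p q = t"
proof -
  have "cosh (sqrt (- k) * model_dist k p q) = cosh (sqrt (- k) * t)"
    using assms(4) cosh_model_dist[OF assms(1,2)] by simp
  then have "\<bar>sqrt (- k) * model_dist k p q\<bar> = \<bar>sqrt (- k) * t\<bar>"
    by (simp only: cosh_real_eq_iff)
  then show ?thesis using k assms(3) by (simp add: abs_mult)
qed

text \<open>The double angle formula makes the difference of the two sides a null vector, and it is
  orthogonal to \<open>m\<close>, so it vanishes.\<close>

lemma hyperbolic_midpoint:
  assumes x: "x \<in> hyperboloid" and y: "y \<in> hyperboloid"
    and m: "is_midpoint hyperboloid (model_dist k) x y m"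
  shows "x + y = (2 * cosh (sqrt (- k) * model_dist k x y / 2)) *\<^sub>R m"
proof -
  define a where "a = cosh (sqrt (- k) * model_dist k x y / 2)"
  have mH: "m \<in> hyperboloid" and half: "model_dist k x m = model_dist k x y / 2" "model_dist k y m = model_dist k x y / 2"
    using m by (auto simp: is_midpoint_def)
  have xm: "lorentz_form x m = - a" and ym: "lorentz_form y m = - a"
    using cosh_model_dist[OF x mH] cosh_model_dist[OF y mH] unfolding half by (simp_all add: a_def)
  have xy: "lorentz_form x y = 1 - 2 * a\<^sup>2"
    using cosh_model_dist[OF x y] cosh_double_cosh[of "sqrt (- k) * model_dist k x y / 2"]
    by (simp add: a_def)
  have "x + y - (2 * a) *\<^sub>R m = 0"
    by (rule lorentz_form_null_imp_zero[OF mH])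
      (use xm ym xy hyperboloid_lorentz_form_self[OF x] hyperboloid_lorentz_form_self[OF y]
          hyperboloid_lorentz_form_self[OF mH]
        in \<open>simp_all add: lorentz_form_simps lorentz_form_diff_minus lorentz_form_commute[of m x] lorentz_form_commute[of m y]
              lorentz_form_commute[of y x] power2_eq_square algebra_simps\<close>)
  then show ?thesis by (simp add: a_def)
qed

text \<open>One direction solves \<open>hyperbolic_midpoint\<close> for \<open>z\<close>, the cosine
  of half the distance being \<open>- lorentz_form x p\<close>; the other is the double angle
  formula. Reflections thereby become explicit in \<open>x\<close> and \<open>p\<close>.\<close>

lemma hyperbolic_is_midpoint_iff:
  assumes x: "x \<in> hyperboloid" and z: "z \<in> hyperboloid" and p: "p \<in> hyperboloid"
  shows "is_midpoint hyperboloid (model_dist k) x z p \<longleftrightarrow> z = - (2 * lorentz_form x p) *\<^sub>R p - x"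
proof
  assume m: "is_midpoint hyperboloid (model_dist k) x z p"
  then have half: "model_dist k x p = model_dist k x z / 2" by (simp add: is_midpoint_def)
  have "cosh (sqrt (- k) * model_dist k x z / 2) = - lorentz_form x p"
    using cosh_model_dist[OF x p] unfolding half by simp
  then show "z = - (2 * lorentz_form x p) *\<^sub>R p - x"
    using hyperbolic_midpoint[OF x z m] by (simp add: algebra_simps)
next
  assume z_eq: "z = - (2 * lorentz_form x p) *\<^sub>R p - x"
  note self = hyperboloid_lorentz_form_self[OF x] hyperboloid_lorentz_form_self[OF p]
  have zp: "- lorentz_form z p = - lorentz_form x p"
    by (simp add: z_eq lorentz_form_simps lorentz_form_diff_minus self)
  have "model_dist k z p = model_dist k x p"
    using cosh_model_dist[OF x p] by (intro model_dist_eqI z p) (simp_all add: zp)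
  moreover have "model_dist k x z = 2 * model_dist k x p"
  proof (intro model_dist_eqI x z)
    have "cosh (sqrt (- k) * (2 * model_dist k x p)) = 2 * (lorentz_form x p)\<^sup>2 - 1"
      using cosh_double_cosh[of "sqrt (- k) * model_dist k x p"] cosh_model_dist[OF x p]
      by (simp add: mult.left_commute)
    then show "- lorentz_form x z = cosh (sqrt (- k) * (2 * model_dist k x p))"
      by (simp add: z_eq lorentz_form_simps lorentz_form_diff_minus self power2_eq_square)
  qed simp
  ultimately show "is_midpoint hyperboloid (model_dist k) x z p"
    using p by (simp add: is_midpoint_def)
qed

text \<open>Removing from \<open>y\<close> its component along \<open>x\<close> and normalising
  gives the unit tangent vector \<open>u\<close> at \<open>x\<close> towards \<open>y\<close>. The
  addition formula for \<open>cosh\<close> shows that the hyperbola branch through \<open>x\<close>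
  in direction \<open>u\<close> has unit speed.\<close>

lemma hyperbolic_geodesic:
  assumes x: "x \<in> hyperboloid" and y: "y \<in> hyperboloid" and "x \<noteq> y"
  obtains u where
    "y = cosh (sqrt (- k) * model_dist k x y) *\<^sub>R x + sinh (sqrt (- k) * model_dist k x y) *\<^sub>R u"
    "geodesic_path hyperboloid (model_dist k) x y
      (\<lambda>s. cosh (sqrt (- k) * s) *\<^sub>R x + sinh (sqrt (- k) * s) *\<^sub>R u)"
proof -
  define D where "D = sqrt (- k) * model_dist k x y"
  define u where "u = (1 / sinh D) *\<^sub>R (y - cosh D *\<^sub>R x)"
  let ?\<gamma> = "\<lambda>s. cosh (sqrt (- k) * s) *\<^sub>R x + sinh (sqrt (- k) * s) *\<^sub>R u"
  note self = hyperboloid_lorentz_form_self[OF x] hyperboloid_lorentz_form_self[OF y]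
  have "model_dist k x y > 0" using assms H.mdist_pos_less by blast
  then have S: "sinh D > 0" using k by (simp add: D_def)
  have xy: "lorentz_form x y = - cosh D" using cosh_model_dist[OF x y] by (simp add: D_def)
  have xu: "lorentz_form x u = 0"
    by (simp add: u_def lorentz_form_simps lorentz_form_diff_minus self xy)
  have "lorentz_form (y - cosh D *\<^sub>R x) (y - cosh D *\<^sub>R x) = (cosh D)\<^sup>2 - 1"
    by (simp add: lorentz_form_simps lorentz_form_diff_minus self xy
        lorentz_form_commute[of y x] power2_eq_square)
  then have uu: "lorentz_form u u = 1"
    using S by (simp add: u_def lorentz_form_simps cosh_square_eq) (simp add: power2_eq_square)
  have form: "- lorentz_form (?\<gamma> s) (?\<gamma> t) = cosh (sqrt (- k) * s - sqrt (- k) * t)" for s t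
    by (simp add: cosh_diff lorentz_form_simps self xu uu lorentz_form_commute[of u x])
  have \<gamma>H: "?\<gamma> s \<in> hyperboloid" for s
    by (rule hyperboloidI[OF _ x])
      (use form[of s s] in \<open>simp_all add: lorentz_form_simps self xu lorentz_form_commute[of u x]\<close>)
  have "model_dist k (?\<gamma> s) (?\<gamma> t) = \<bar>s - t\<bar>" for s t
  proof (rule model_dist_eqI[OF \<gamma>H \<gamma>H])
    have "sqrt (- k) * \<bar>s - t\<bar> = \<bar>sqrt (- k) * s - sqrt (- k) * t\<bar>"
      using k by (simp add: abs_mult flip: right_diff_distrib)
    then show "- lorentz_form (?\<gamma> s) (?\<gamma> t) = cosh (sqrt (- k) * \<bar>s - t\<bar>)"
      using form[of s t] by simp
  qed simp
  moreover have "y = cosh D *\<^sub>R x + sinh D *\<^sub>R u" using S by (simp add: u_def)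
  ultimately show thesis
    using \<gamma>H x y by (intro that[of u]) (auto simp: geodesic_path_def D_def)
qed

text \<open>The angle at the foot of a perpendicular is at least \<open>\<pi> / 2\<close>, so the hyperbolic law of cosines
  gives \<open>cosh (d x q) \<ge> cosh (d x p) * cosh (d p q)\<close>.\<close>

lemma hyperbolic_nearest_point_obtuse:
  assumes C: "geodesically_convex hyperboloid (model_dist k) C" and x: "x \<in> hyperboloid"
    and p: "nearest_point (model_dist k) C x p" and q: "q \<in> C"
  shows "lorentz_form x p * lorentz_form p q \<le> - lorentz_form x q"
proof (cases "p = q")
  case True
  have "p \<in> hyperboloid" using p geodesically_convex_mem[OF C] by (simp add: nearest_point_def)
  then show ?thesis using True hyperboloid_lorentz_form_self[of p] by simp
next
  case False
  have pC: "p \<in> C" using p by (simp add: nearest_point_def)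
  note pH = geodesically_convex_mem[OF C pC] and qH = geodesically_convex_mem[OF C q]
  obtain u where
    q_eq: "q = cosh (sqrt (- k) * model_dist k p q) *\<^sub>R p + sinh (sqrt (- k) * model_dist k p q) *\<^sub>R u"
    and path: "geodesic_path hyperboloid (model_dist k) p q
      (\<lambda>s. cosh (sqrt (- k) * s) *\<^sub>R p + sinh (sqrt (- k) * s) *\<^sub>R u)"
      (is "geodesic_path _ _ _ _ ?\<gamma>")
    by (rule hyperbolic_geodesic[OF pH qH False])
  \<comment> \<open>Along the geodesic,
    \<open>cosh (sqrt (- k) * s) * a + sinh (sqrt (- k) * s) * e\<close> is the gauge of the
    distance to \<open>x\<close>. So \<open>e\<close> is a positive multiple of its derivative at 0,
    and \<open>e \<ge> 0\<close> expresses the obtuse angle at \<open>p\<close>.\<close>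
  define a where "a = - lorentz_form x p"
  define e where "e = - lorentz_form x u"
  have D: "model_dist k p q > 0" using False pH qH H.mdist_pos_less by blast
  have "?\<gamma> ` {0..model_dist k p q} \<subseteq> C"
    using C pC q path unfolding geodesically_convex_def geodesic_segment_def by blast
  then have \<gamma>C: "?\<gamma> s \<in> C" if "0 < s" "s \<le> model_dist k p q" for s using that by auto
  \<comment> \<open>First variation without derivatives: in terms of half the parameter, the
    increase over \<open>a\<close> has the positive factor \<open>2 * sinh ?h\<close>. After
    dividing it out, letting \<open>s\<close> tend to 0 leaves \<open>0 \<le> e\<close>.\<close>
  have first_order: "- e * cosh (sqrt (- k) * s / 2) \<le> sinh (sqrt (- k) * s / 2) * a"
    if s: "0 < s" "s \<le> model_dist k p q" for s
  proof -
    let ?h = "sqrt (- k) * s / 2"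
    have "model_dist k x p \<le> model_dist k x (?\<gamma> s)"
      using p \<gamma>C[OF s] by (simp add: nearest_point_def)
    then have "a \<le> - lorentz_form x (?\<gamma> s)"
      using model_dist_le_iff[OF x pH H.nonneg[of x "?\<gamma> s"]] cosh_model_dist[OF x geodesically_convex_mem[OF C \<gamma>C[OF s]]]
      by (simp add: a_def)
    also have "\<dots> = cosh (2 * ?h) * a + sinh (2 * ?h) * e"
      by (simp add: a_def e_def lorentz_form_simps)
    also have "\<dots> = a + 2 * sinh ?h * (sinh ?h * a + cosh ?h * e)"
      unfolding cosh_double sinh_double cosh_square_eq by (simp add: power2_eq_square algebra_simps)
    finally have "0 \<le> 2 * sinh ?h * (sinh ?h * a + cosh ?h * e)" by simp
    moreover have "0 < 2 * sinh ?h" using s k by simp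
    ultimately have "0 \<le> sinh ?h * a + cosh ?h * e"
      by (meson linorder_not_le mult_pos_neg)
    then show ?thesis by (simp add: mult.commute)
  qed
  have "- e * cosh (sqrt (- k) * 0 / 2) \<le> sinh (sqrt (- k) * 0 / 2) * a"
  proof (rule tendsto_le)
    show "((\<lambda>s. sinh (sqrt (- k) * s / 2) * a) \<longlongrightarrow> sinh (sqrt (- k) * 0 / 2) * a) (at_right 0)"
      by (intro tendsto_intros) auto
    show "((\<lambda>s. - e * cosh (sqrt (- k) * s / 2)) \<longlongrightarrow> - e * cosh (sqrt (- k) * 0 / 2)) (at_right 0)"
      by (intro tendsto_intros) auto
    show "\<forall>\<^sub>F s in at_right 0. - e * cosh (sqrt (- k) * s / 2) \<le> sinh (sqrt (- k) * s / 2) * a"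
      using D first_order by (auto simp: eventually_at_right intro!: exI[of _ "model_dist k p q"])
  qed simp
  then have "0 \<le> e" by simp
  have "- lorentz_form x q = cosh (sqrt (- k) * model_dist k p q) * a + sinh (sqrt (- k) * model_dist k p q) * e"
    by (subst q_eq) (simp add: a_def e_def lorentz_form_simps)
  moreover have "0 \<le> sinh (sqrt (- k) * model_dist k p q) * e"
    using \<open>0 \<le> e\<close> D k by simp
  ultimately show ?thesis
    using cosh_model_dist[OF pH qH] by (simp add: a_def algebra_simps)
qed

section \<open>Nonexpansiveness of hyperbolic reflections\<close>

text \<open>Expanding the form of the two reflected points produces a term with
  \<open>lorentz_form p q\<close> and coefficient 4. Splitting it evenly writes the excess over
  \<open>lorentz_form x y\<close> as two products of nonpositive factors.\<close>

lemma hyperbolic_reflection_nonexpansive: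
  fixes x y p q :: "(real ^ 'm) \<times> real"
  assumes xp: "lorentz_form x p \<le> 0" and yq: "lorentz_form y q \<le> 0"
    and p: "lorentz_form x p * lorentz_form p q \<le> - lorentz_form x q"
    and q: "lorentz_form y q * lorentz_form q p \<le> - lorentz_form y p"
  shows "- lorentz_form (- (2 * lorentz_form x p) *\<^sub>R p - x) (- (2 * lorentz_form y q) *\<^sub>R q - y)
    \<le> - lorentz_form x y"
proof -
  have "lorentz_form y q * (- lorentz_form x q) \<le> lorentz_form y q * (lorentz_form x p * lorentz_form p q)"
    using p yq by (rule mult_left_mono_neg)
  moreover have "lorentz_form x p * (- lorentz_form y p) \<le> lorentz_form x p * (lorentz_form y q * lorentz_form p q)"
    using q xp by (intro mult_left_mono_neg) (simp_all add: lorentz_form_commute)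
  ultimately show ?thesis
    by (simp add: lorentz_form_simps lorentz_form_diff_minus lorentz_form_commute[of p y] algebra_simps)
qed

section \<open>Compactness and the abstract setting in hyperbolic space\<close>

text \<open>Pairing with the apex \<open>(0, 1)\<close> reads off the last coordinate up to sign, so
  bounded distance gives boundedness in the ambient space. Euclidean convergence then passes through
  the form and \<open>arcosh\<close>.\<close>

lemma hyperbolic_bounded_subsequence:
  fixes \<sigma> :: "nat \<Rightarrow> (real ^ 'm) \<times> real"
  assumes \<sigma>: "range \<sigma> \<subseteq> hyperboloid" and z: "z \<in> hyperboloid" and b: "\<And>n. model_dist k (\<sigma> n) z \<le> b"
  shows "\<exists>l\<in>hyperboloid. \<exists>r. strict_mono r \<and> (\<lambda>n. model_dist k (\<sigma> (r n)) l) \<longlonglongrightarrow> 0"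
proof -
  let ?o = "(0, 1) :: (real ^ 'm) \<times> real"
  have o: "?o \<in> hyperboloid" by (simp add: hyperboloid_def lorentz_form_def)
  have \<sigma>H: "\<sigma> n \<in> hyperboloid" for n using \<sigma> by auto
  have snd_ge: "snd p \<ge> 1" and fst_norm: "(norm (fst p))\<^sup>2 = (snd p)\<^sup>2 - 1"
    if "p \<in> hyperboloid" for p :: "(real ^ 'm) \<times> real"
    using hyperboloid_lorentz_form(1)[OF that o] hyperboloid_lorentz_form_self[OF that]
    by (auto simp: lorentz_form_def power2_norm_eq_inner power2_eq_square[of "snd p"])
  define R where "R = cosh (sqrt (- k) * (b + model_dist k z ?o))"
  have snd_le: "snd (\<sigma> n) \<le> R" for n
  proof -
    have "model_dist k (\<sigma> n) ?o \<le> b + model_dist k z ?o"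
      using H.triangle[OF \<sigma>H z o, of n] b[of n] by linarith
    then show ?thesis
      using model_dist_le_iff[OF \<sigma>H o, of "b + model_dist k z ?o" n] H.nonneg[of "\<sigma> n" ?o]
      by (simp add: R_def lorentz_form_def)
  qed
  \<comment> \<open>The lower end 1 survives the limit and keeps \<open>l\<close> on the upper
    sheet.\<close>
  have "\<sigma> n \<in> cball 0 R \<times> {1..R}" for n
  proof -
    have "(norm (fst (\<sigma> n)))\<^sup>2 \<le> (snd (\<sigma> n))\<^sup>2"
      using fst_norm[OF \<sigma>H, of n] by simp
    then have "norm (fst (\<sigma> n)) \<le> snd (\<sigma> n)"
      by (rule power2_le_imp_le) (use snd_ge[OF \<sigma>H, of n] in simp)
    then show ?thesis using snd_le[of n] snd_ge[OF \<sigma>H, of n] by (simp add: mem_Times_iff)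
  qed
  then have "\<forall>n. \<sigma> n \<in> cball 0 R \<times> {1..R}" by blast
  moreover have "compact (cball (0 :: real ^ 'm) R \<times> {1..R})"
    by (rule compact_Times[OF compact_cball compact_Icc])
  ultimately obtain l r where l: "l \<in> cball 0 R \<times> {1..R}" and r: "strict_mono r" and lim: "(\<sigma> \<circ> r) \<longlonglongrightarrow> l"
    unfolding compact_def by blast
  have form: "(\<lambda>n. lorentz_form (\<sigma> (r n)) l) \<longlonglongrightarrow> lorentz_form l l"
    "(\<lambda>n. lorentz_form (\<sigma> (r n)) (\<sigma> (r n))) \<longlonglongrightarrow> lorentz_form l l"
    using lim unfolding lorentz_form_def o_def
    by (intro tendsto_diff tendsto_inner tendsto_mult tendsto_fst tendsto_snd tendsto_const; assumption)+
  have ll: "lorentz_form l l = -1"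
    using form(2) hyperboloid_lorentz_form_self[OF \<sigma>H] by (simp add: LIMSEQ_const_iff)
  then have lH: "l \<in> hyperboloid" using l by (auto simp: hyperboloid_def)
  \<comment> \<open>The limit 1 is the left end of the domain of \<open>arcosh\<close>, so the terms
    must also be known to be at least 1.\<close>
  have "(\<lambda>n. arcosh (- lorentz_form (\<sigma> (r n)) l)) \<longlonglongrightarrow> arcosh 1"
    using tendsto_minus[OF form(1)] ll hyperboloid_lorentz_form(1)[OF \<sigma>H lH]
    by (intro tendsto_arcosh_strong) auto
  then have "(\<lambda>n. 1 / sqrt (- k) * arcosh (- lorentz_form (\<sigma> (r n)) l)) \<longlonglongrightarrow> 0"
    by (metis arcosh_1 tendsto_mult_right_zero)
  then have "(\<lambda>n. model_dist k (\<sigma> (r n)) l) \<longlonglongrightarrow> 0"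
    using k \<sigma>H lH by (simp add: model_dist_def hyperbolic_dist_def)
  then show ?thesis using lH r by blast
qed

text \<open>Pairing \<open>hyperbolic_midpoint\<close> with \<open>z\<close> shows that the average
  of the two gauges is exactly \<open>a\<close> times the gauge at the midpoint. That gauge is at
  least 1, so the gap is at least \<open>a - 1\<close>.\<close>

lemma reflection_space_hyperbolic:
  "reflection_space (model_space k :: ((real ^ 'm) \<times> real) set) (model_dist k)
     (\<lambda>s. cosh (sqrt (- k) * s)) (- k / 8)"
  unfolding model_space_neg
proof
  let ?H = "hyperboloid :: ((real ^ 'm) \<times> real) set" and ?d = "model_dist k"
  show "strict_mono_on {0..} (\<lambda>s. cosh (sqrt (- k) * s))"
    using sqrt_curvature_pos by (intro strict_mono_onI) (simp add: cosh_real_nonneg_less_iff)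
  show "continuous_on UNIV (\<lambda>s. cosh (sqrt (- k) * s))" by (intro continuous_intros)
  show "- k / 8 > 0" using k by simp
  fix x y :: "(real ^ 'm) \<times> real"
  assume x: "x \<in> ?H" and y: "y \<in> ?H"
  show "\<exists>\<gamma>. geodesic_path ?H ?d x y \<gamma>"
  proof (cases "x = y")
    case True
    then show ?thesis using x by (intro exI[of _ "\<lambda>_. x"]) (simp add: geodesic_path_def)
  next
    case False
    then show ?thesis using hyperbolic_geodesic[OF x y] by blast
  qed
  fix z m :: "(real ^ 'm) \<times> real"
  assume z: "z \<in> ?H" and m: "is_midpoint ?H ?d x y m"
  define a where "a = cosh (sqrt (- k) * ?d x y / 2)"
  have mH: "m \<in> ?H" using m by (simp add: is_midpoint_def)
  have "lorentz_form (x + y) z = lorentz_form ((2 * a) *\<^sub>R m) z"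
    using hyperbolic_midpoint[OF x y m] by (simp add: a_def)
  then have avg: "- lorentz_form m z * a = (- lorentz_form x z + - lorentz_form y z) / 2"
    by (simp add: lorentz_form_simps field_simps)
  \<comment> \<open>The constant is \<open>t\<^sup>2 / 2\<close> at
    \<open>t = sqrt (- k) * ?d x y / 2\<close>.\<close>
  have "1 + - k / 8 * (?d x y)\<^sup>2 \<le> a"
    using cosh_ge_quadratic[of "sqrt (- k) * ?d x y / 2"] k
    by (simp add: a_def power_divide power_mult_distrib)
  moreover have "a \<ge> 1" by (simp add: a_def cosh_real_ge_1)
  then have "1 * (a - 1) \<le> - lorentz_form m z * (a - 1)"
    using hyperboloid_lorentz_form(1)[OF mH z] by (intro mult_right_mono) auto
  ultimately show "cosh (sqrt (- k) * ?d m z) + - k / 8 * (?d x y)\<^sup>2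
      \<le> (cosh (sqrt (- k) * ?d x z) + cosh (sqrt (- k) * ?d y z)) / 2"
    unfolding cosh_model_dist[OF mH z] cosh_model_dist[OF x z] cosh_model_dist[OF y z]
    using avg by (simp add: algebra_simps)
next
  fix x p :: "(real ^ 'm) \<times> real"
  assume x: "x \<in> hyperboloid" and p: "p \<in> hyperboloid"
  show "\<exists>!z. z \<in> hyperboloid \<and> is_midpoint hyperboloid (model_dist k) x z p"
    using hyperbolic_reflection_mem[OF x p] hyperbolic_is_midpoint_iff[OF x _ p]
    by (intro ex1I[of _ "- (2 * lorentz_form x p) *\<^sub>R p - x"]) auto
next
  fix C and x y p q u v :: "(real ^ 'm) \<times> real"
  assume C: "geodesically_convex hyperboloid (model_dist k) C"
    and x: "x \<in> hyperboloid" and y: "y \<in> hyperboloid"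
    and p: "nearest_point (model_dist k) C x p" and q: "nearest_point (model_dist k) C y q"
    and u: "u \<in> hyperboloid" and v: "v \<in> hyperboloid"
    and up: "is_midpoint hyperboloid (model_dist k) x u p"
    and vq: "is_midpoint hyperboloid (model_dist k) y v q"
  have pC: "p \<in> C" and qC: "q \<in> C" using p q by (auto simp: nearest_point_def)
  note pH = geodesically_convex_mem[OF C pC] and qH = geodesically_convex_mem[OF C qC]
  have "lorentz_form x p \<le> 0" "lorentz_form y q \<le> 0"
    using hyperboloid_lorentz_form(1)[OF x pH] hyperboloid_lorentz_form(1)[OF y qH] by auto
  then have "- lorentz_form u v \<le> - lorentz_form x y"
    using hyperbolic_is_midpoint_iff[OF x u pH] hyperbolic_is_midpoint_iff[OF y v qH] up vq
      hyperbolic_reflection_nonexpansive hyperbolic_nearest_point_obtuse[OF C x p qC]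
      hyperbolic_nearest_point_obtuse[OF C y q pC] by metis
  then show "model_dist k u v \<le> model_dist k x y"
    using cosh_model_dist[OF x y] by (simp add: model_dist_le_iff[OF u v])
qed (rule hyperbolic_bounded_subsequence)

end

section \<open>Averaged alternating reflections in model spaces\<close>

theorem theorem3p4:
  fixes k :: real
    and A B :: "((real ^ 'm) \<times> real) set"
    and x\<^sub>0 :: "(real ^ 'm) \<times> real"
  defines "M \<equiv> (model_space k :: ((real ^ 'm) \<times> real) set)"
    and "d \<equiv> (model_dist k :: (real ^ 'm) \<times> real \<Rightarrow> (real ^ 'm) \<times> real \<Rightarrow> real)"
  defines "T \<equiv> aar_map M d A B"
    and "P \<equiv> metric_projection d B"
  assumes "k \<le> 0"
    and "A \<noteq> {}" "closedin (Metric_space.mtopology M d) A" "geodesically_convex M d A"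
    and "B \<noteq> {}" "closedin (Metric_space.mtopology M d) B" "geodesically_convex M d B"
    and "A \<inter> B \<noteq> {}"
    and "x\<^sub>0 \<in> M"
  shows "(\<exists>x\<in>M. T x = x \<and>
            limitin (Metric_space.mtopology M d) (\<lambda>n. (T ^^ n) x\<^sub>0) x sequentially \<and>
            P x \<in> A \<inter> B) \<and>
         (\<exists>y\<in>A \<inter> B.
            limitin (Metric_space.mtopology M d) (\<lambda>n. P ((T ^^ n) x\<^sub>0)) y sequentially)"
proof -
  \<comment> \<open>The two models need different gauges and moduli, but the abstract conclusion
    mentions neither, so existence is enough.\<close>
  have "\<exists>\<phi> c. reflection_space M d \<phi> c"
  proof (cases "k = 0")
    case True
    then show ?thesis unfolding M_def d_def using reflection_space_euclidean by blast
  next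
    case False
    then show ?thesis
      unfolding M_def d_def using reflection_space_hyperbolic[of k] \<open>k \<le> 0\<close> by force
  qed
  then obtain \<phi> c where "reflection_space M d \<phi> c" by blast
  then interpret reflection_space M d \<phi> c .
  show ?thesis
    unfolding T_def P_def by (rule averaged_alternating_reflections) fact+
qed

end
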